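(* Let $n\ge 3$ be an integer and let $v$ be an irrational unit vector in $\mathbb{R}^n$. Then for every $r>0$ there exists a symplectic embedding from $P^{2n}(r)$ to $Y^{2n}(1,v)$. In particular, any bounded domain in $T^*\mathbb{T}^n$ can be symplectically embedded into $Y^{2n}(1,v)$.
   Context: $\mathbb{T}^n=\mathbb{R}^n/\mathbb{Z}^n$, and $T^*\mathbb{T}^n=\mathbb{T}^n\times\mathbb{R}^n$ carries the canonical symplectic form $\omega_{\mathrm{can}}=d\lambda_{\mathrm{can}}$. A vector $v\in\mathbb{R}^n$ is irrational if it is not a scalar multiple of any integer vector in $\mathbb{R}^n$. For $r>0$ and a unit vector $v\in\mathbb{R}^n$ define $$P^{2n}(r)=\mathbb{T}^n\times\{(x_1,\dots,x_n)\in\mathbb{R}_{\ge 0}^n : x_1+\cdots+x_n\le r\},$$ $$Y^{2n}(r,v)=\mathbb{T}^n\times(-r,r)v\times v^{\perp},$$ where $v^\perp$ is the hyperplane through the origin in the fiber $\mathbb{R}^n$ perpendicular to $v$; that is, $Y^{2n}(r,v)=\{(q,p)\in\mathbb{T}^n\times\mathbb{R}^n : |p\cdot v|<r\}$. A domain in $T^*\mathbb{T}^n$ is bounded if its projection to the fiber factor $\mathbb{R}^n$ is bounded. A symplectic embedding of a subset $S\subset T^*\mathbb{T}^n$ that is not open (such as $P^{2n}(r)$) into $Y$ means a map $S\to Y$ that is the restriction to $S$ of a smooth embedding $\Phi$ of an open neighbourhood of $S$ into $T^*\mathbb{T}^n$ with $\Phi^*\omega_{\mathrm{can}}=\omega_{\mathrm{can}}$.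 *)

theory Defs
  imports "HOL-Analysis.Analysis"
begin

definition integer_vectors :: "(real ^ 'n) set" where
  "integer_vectors = {z. \<forall>i. z $ i \<in> \<int>}"

definition irrational_vector :: "real ^ 'n \<Rightarrow> bool" where
  "irrational_vector v \<longleftrightarrow> \<not> (\<exists>c. \<exists>z\<in>integer_vectors. v = c *\<^sub>R z)"


section \<open>The torus and its cotangent bundle\<close>

definition lattice_rel :: "real ^ 'n \<Rightarrow> real ^ 'n \<Rightarrow> bool" where
  "lattice_rel x y \<longleftrightarrow> x - y \<in> integer_vectors"

lemma equivp_lattice_rel: "equivp lattice_rel"
proof (rule equivpI)
  show "reflp lattice_rel"
    by (simp add: reflp_def lattice_rel_def integer_vectors_def)
  show "symp lattice_rel"
  proof (rule sympI)
    fix x y :: "real ^ 'n"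
    assume "lattice_rel x y"
    then have "- (x $ i - y $ i) \<in> \<int>" for i
      unfolding lattice_rel_def integer_vectors_def by (intro Ints_minus) simp
    then show "lattice_rel y x"
      by (simp add: lattice_rel_def integer_vectors_def)
  qed
  show "transp lattice_rel"
  proof (rule transpI)
    fix x y z :: "real ^ 'n"
    assume "lattice_rel x y" "lattice_rel y z"
    then have "(x $ i - y $ i) + (y $ i - z $ i) \<in> \<int>" for i
      unfolding lattice_rel_def integer_vectors_def by (intro Ints_add) simp_all
    then show "lattice_rel x z"
      by (simp add: lattice_rel_def integer_vectors_def)
  qed
qed

quotient_type (overloaded) 'n torus = "real ^ ('n::finite)" / lattice_rel
  morphisms rep_torus torus_proj
  by (rule equivp_lattice_rel)

instantiation torus :: (finite) topological_space
begin

definition open_torus :: "'a torus set \<Rightarrow> bool" where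
  "open_torus U \<longleftrightarrow> open (torus_proj -` U)"

instance
  by standard (auto simp: open_torus_def vimage_Union vimage_Int)

end

type_synonym 'n cotangent_torus = "'n torus \<times> (real ^ 'n)"

text \<open>
  The universal covering of the cotangent bundle.  The smooth structure downstairs is the one
  for which this map is a local diffeomorphism, so its tangent spaces are all identified with
  the vector space upstairs, and smoothness, differentials and pullbacks are computed on local
  lifts.  Two continuous lifts over a connected set differ by a constant lattice translation,
  so the choice of lift is immaterial.
\<close>

definition cot_proj :: "(real ^ 'n) \<times> (real ^ 'n) \<Rightarrow> 'n::finite cotangent_torus" where
  "cot_proj z = (torus_proj (fst z), snd z)"


section \<open>Smooth maps\<close>

text \<open>Both predicates are meant for open sets \<open>S\<close> in finite-dimensional spaces.\<close>

primrec C_k_on ::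
  "nat \<Rightarrow> 'a::real_normed_vector set \<Rightarrow> ('a \<Rightarrow> 'b::real_normed_vector) \<Rightarrow> bool" where
  "C_k_on 0 S f \<longleftrightarrow> continuous_on S f"
| "C_k_on (Suc k) S f \<longleftrightarrow> (\<forall>x\<in>S. f differentiable at x) \<and>
     (\<forall>u. C_k_on k S (\<lambda>x. frechet_derivative f (at x) u))"

definition smooth_on :: "'a::real_normed_vector set \<Rightarrow> ('a \<Rightarrow> 'b::real_normed_vector) \<Rightarrow> bool" where
  "smooth_on S f \<longleftrightarrow> (\<forall>k. C_k_on k S f)"

definition local_lift ::
  "'n::finite cotangent_torus set \<Rightarrow> ('n cotangent_torus \<Rightarrow> 'n cotangent_torus) \<Rightarrow>
   ((real ^ 'n) \<times> (real ^ 'n)) set \<Rightarrow>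
   ((real ^ 'n) \<times> (real ^ 'n) \<Rightarrow> (real ^ 'n) \<times> (real ^ 'n)) \<Rightarrow> bool" where
  "local_lift U \<Phi> W F \<longleftrightarrow> open W \<and> cot_proj ` W \<subseteq> U \<and> continuous_on W F \<and>
     (\<forall>w\<in>W. cot_proj (F w) = \<Phi> (cot_proj w))"

definition smooth_map ::
  "'n::finite cotangent_torus set \<Rightarrow> ('n cotangent_torus \<Rightarrow> 'n cotangent_torus) \<Rightarrow> bool" where
  "smooth_map U \<Phi> \<longleftrightarrow>
     (\<forall>z. cot_proj z \<in> U \<longrightarrow> (\<exists>W F. z \<in> W \<and> local_lift U \<Phi> W F \<and> smooth_on W F))"

definition immersion ::
  "'n::finite cotangent_torus set \<Rightarrow> ('n cotangent_torus \<Rightarrow> 'n cotangent_torus) \<Rightarrow> bool" where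
  "immersion U \<Phi> \<longleftrightarrow> smooth_map U \<Phi> \<and>
     (\<forall>W F. local_lift U \<Phi> W F \<longrightarrow> (\<forall>w\<in>W. inj (frechet_derivative F (at w))))"

definition smooth_embedding ::
  "'n::finite cotangent_torus set \<Rightarrow> ('n cotangent_torus \<Rightarrow> 'n cotangent_torus) \<Rightarrow> bool" where
  "smooth_embedding U \<Phi> \<longleftrightarrow> immersion U \<Phi> \<and> (\<exists>\<Psi>. homeomorphism U (\<Phi> ` U) \<Phi> \<Psi>)"


section \<open>The canonical symplectic form\<close>

text \<open>
  Differential forms are written on the universal cover; the canonical one-form does not
  depend on the base point \<open>q\<close>, hence descends.
\<close>

definition lambda_can ::
  "(real ^ 'n) \<times> (real ^ 'n) \<Rightarrow> (real ^ 'n) \<times> (real ^ 'n) \<Rightarrow> real" where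
  "lambda_can z \<xi> = snd z \<bullet> fst \<xi>"

text \<open>The exterior derivative of a one-form, evaluated on constant vector fields.\<close>

definition ext_deriv :: "('a::real_normed_vector \<Rightarrow> 'a \<Rightarrow> real) \<Rightarrow> 'a \<Rightarrow> 'a \<Rightarrow> 'a \<Rightarrow> real" where
  "ext_deriv \<alpha> z \<xi> \<eta> =
     frechet_derivative (\<lambda>w. \<alpha> w \<eta>) (at z) \<xi> - frechet_derivative (\<lambda>w. \<alpha> w \<xi>) (at z) \<eta>"

definition omega_can ::
  "(real ^ 'n) \<times> (real ^ 'n) \<Rightarrow> (real ^ 'n) \<times> (real ^ 'n) \<Rightarrow> (real ^ 'n) \<times> (real ^ 'n) \<Rightarrow> real"
  where "omega_can = ext_deriv lambda_can"

lemma omega_can_eq: "omega_can z \<xi> \<eta> = snd \<xi> \<bullet> fst \<eta> - snd \<eta> \<bullet> fst \<xi>"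
proof -
  have "frechet_derivative (\<lambda>w. lambda_can w \<zeta>) (at z) = (\<lambda>u. snd u \<bullet> fst \<zeta>)" for \<zeta>
    unfolding lambda_can_def
    by (rule frechet_derivative_at [symmetric]) (auto intro!: derivative_eq_intros)
  then show ?thesis
    by (simp add: omega_can_def ext_deriv_def)
qed

definition preserves_omega ::
  "'n::finite cotangent_torus set \<Rightarrow> ('n cotangent_torus \<Rightarrow> 'n cotangent_torus) \<Rightarrow> bool" where
  "preserves_omega U \<Phi> \<longleftrightarrow>
     (\<forall>W F. local_lift U \<Phi> W F \<longrightarrow>
        (\<forall>w\<in>W. \<forall>\<xi> \<eta>. omega_can (F w) (frechet_derivative F (at w) \<xi>) (frechet_derivative F (at w) \<eta>)
                      = omega_can w \<xi> \<eta>))"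

text \<open>For open \<open>S\<close> one may take \<open>U = S\<close>, and the notion is the usual one.\<close>

definition symplectic_embedding ::
  "'n::finite cotangent_torus set \<Rightarrow> 'n cotangent_torus set \<Rightarrow>
   ('n cotangent_torus \<Rightarrow> 'n cotangent_torus) \<Rightarrow> bool" where
  "symplectic_embedding S Y f \<longleftrightarrow> f ` S \<subseteq> Y \<and>
     (\<exists>U \<Phi>. open U \<and> S \<subseteq> U \<and> (\<forall>x\<in>S. f x = \<Phi> x) \<and>
            smooth_embedding U \<Phi> \<and> preserves_omega U \<Phi>)"


section \<open>Domains\<close>

definition P_domain :: "real \<Rightarrow> 'n::finite cotangent_torus set" where
  "P_domain r = UNIV \<times> {x. (\<forall>i. 0 \<le> x $ i) \<and> (\<Sum>i\<in>UNIV. x $ i) \<le> r}"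

definition Y_domain :: "real \<Rightarrow> real ^ 'n \<Rightarrow> 'n::finite cotangent_torus set" where
  "Y_domain r v = UNIV \<times> {s *\<^sub>R v + w |s w. - r < s \<and> s < r \<and> w \<bullet> v = 0}"

lemma Y_domain_eq:
  assumes "norm v = 1"
  shows "Y_domain r v = {(q, p). \<bar>p \<bullet> v\<bar> < r}"
proof -
  have vv: "v \<bullet> v = 1"
    using assms by (simp add: dot_square_norm)
  have "p \<in> {s *\<^sub>R v + w |s w. - r < s \<and> s < r \<and> w \<bullet> v = 0} \<longleftrightarrow> \<bar>p \<bullet> v\<bar> < r" for p
  proof
    assume "p \<in> {s *\<^sub>R v + w |s w. - r < s \<and> s < r \<and> w \<bullet> v = 0}"
    then show "\<bar>p \<bullet> v\<bar> < r"
      by (auto simp: inner_add_left vv)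
  next
    assume *: "\<bar>p \<bullet> v\<bar> < r"
    have "(p - (p \<bullet> v) *\<^sub>R v) \<bullet> v = 0"
      by (simp add: inner_diff_left vv)
    with * have "p = (p \<bullet> v) *\<^sub>R v + (p - (p \<bullet> v) *\<^sub>R v) \<and> - r < p \<bullet> v \<and> p \<bullet> v < r \<and>
        (p - (p \<bullet> v) *\<^sub>R v) \<bullet> v = 0"
      by (simp add: abs_less_iff minus_less_iff)
    then show "p \<in> {s *\<^sub>R v + w |s w. - r < s \<and> s < r \<and> w \<bullet> v = 0}"
      by blast
  qed
  then show ?thesis
    by (auto simp: Y_domain_def)
qed

text \<open>
  A domain is a nonempty connected open set together with none, some or all of its boundary
  points, so that both open domains and closed ones such as \<^const>\<open>P_domain\<close> are covered.
\<close>

definition is_domain :: "'a::topological_space set \<Rightarrow> bool" where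
  "is_domain D \<longleftrightarrow> (\<exists>U. open U \<and> connected U \<and> U \<noteq> {} \<and> U \<subseteq> D \<and> D \<subseteq> closure U)"

definition fiber_bounded :: "'n::finite cotangent_torus set \<Rightarrow> bool" where
  "fiber_bounded D \<longleftrightarrow> bounded (snd ` D)"

end

theory Submission
  imports Defs
begin

text \<open>
  Linear symplectic maps suffice.  A matrix \<open>A\<close> in \<open>GL(n, \<int>)\<close> with inverse \<open>B\<close> acts on the
  torus, and its cotangent lift \<open>(q, p) \<mapsto> (A q, B\<^sup>T p)\<close> is a symplectic diffeomorphism of the
  whole of \<open>T\<^sup>*\<bbbT>\<^sup>n\<close>.  Since \<open>B\<^sup>T p \<bullet> v = p \<bullet> B v\<close>, this lift sends a set whose fiber
  coordinates have norm at most \<open>R\<close> into \<open>Y(1, v)\<close> as soon as \<open>R \<cdot> norm (B v) < 1\<close>.  It remains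
  to see that the orbit of \<open>v\<close> under \<open>GL(n, \<int>)\<close> accumulates at the origin, which is where
  irrationality enters (\<open>irrational_orbit_small\<close>).

  The accumulation is a Euclidean algorithm in \<open>n\<close> real variables.  Given an orbit vector \<open>w\<close>
  and a nonzero coordinate \<open>w\<^sub>j\<close>, a shear subtracts from every other coordinate the nearest
  integer multiple of \<open>w\<^sub>j\<close>, leaving a remainder of size at most \<open>\<bar>w\<^sub>j\<bar> / 2\<close>.  If all remainders
  vanished, an orbit vector, hence \<open>v\<close> itself, would be a multiple of an integer vector.  So
  some remainder is nonzero; it becomes the next pivot, at most half as large as the previous
  one.  Once the pivot is tiny, one more reduction makes every coordinate tiny.
\<close>

section \<open>Integer matrices with integer inverse\<close>

definition integer_matrix :: "real ^ 'n ^ 'n \<Rightarrow> bool" where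
  "integer_matrix A \<longleftrightarrow> (\<forall>i j. A $ i $ j \<in> \<int>)"

definition integer_inverses :: "real ^ 'n ^ 'n \<Rightarrow> real ^ 'n ^ 'n \<Rightarrow> bool" where
  "integer_inverses A B \<longleftrightarrow> integer_matrix A \<and> integer_matrix B \<and> A ** B = mat 1"

lemma integer_inverses_commute: "integer_inverses A B \<Longrightarrow> integer_inverses B A"
  unfolding integer_inverses_def by (metis matrix_left_right_inverse)

lemma integer_inverses_cancel: "integer_inverses A B \<Longrightarrow> A *v (B *v x) = x"
  by (simp add: integer_inverses_def matrix_vector_mul_assoc)

lemma integer_matrix_mul:
  "integer_matrix A \<Longrightarrow> integer_matrix B \<Longrightarrow> integer_matrix (A ** B)"
  by (auto simp: integer_matrix_def matrix_matrix_mult_def intro!: Ints_sum Ints_mult)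

lemma integer_inverses_mul:
  assumes "integer_inverses A B" "integer_inverses C D"
  shows "integer_inverses (A ** C) (D ** B)"
proof -
  have "(A ** C) ** (D ** B) = A ** (C ** D) ** B"
    by (simp add: matrix_mul_assoc)
  then show ?thesis
    using assms by (simp add: integer_inverses_def integer_matrix_mul)
qed

lemma integer_inverses_mat_1: "integer_inverses (mat 1) (mat 1)"
proof -
  have "integer_matrix (mat 1)"
    by (simp add: integer_matrix_def mat_def)
  then show ?thesis
    by (simp add: integer_inverses_def)
qed

lemma integer_matrix_vector_mul:
  "integer_matrix A \<Longrightarrow> x \<in> integer_vectors \<Longrightarrow> A *v x \<in> integer_vectors"
  by (auto simp: integer_matrix_def integer_vectors_def matrix_vector_mult_def
      intro!: Ints_sum Ints_mult)

lemma irrational_vector_integer_inverses: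
  assumes "integer_inverses A B" "irrational_vector v"
  shows "irrational_vector (B *v v)"
  unfolding irrational_vector_def
proof (intro notI, elim exE bexE)
  fix c z
  assume z: "z \<in> integer_vectors" and eq: "B *v v = c *\<^sub>R z"
  have "v = c *\<^sub>R (A *v z)"
    using integer_inverses_cancel[OF assms(1), of v] eq by (simp add: matrix_vector_mult_scaleR)
  moreover have "A *v z \<in> integer_vectors"
    using assms(1) z by (simp add: integer_inverses_def integer_matrix_vector_mul)
  ultimately show False
    using assms(2) unfolding irrational_vector_def by blast
qed


section \<open>A Euclidean algorithm for irrational vectors\<close>

definition shear :: "'n \<Rightarrow> real ^ 'n \<Rightarrow> real ^ 'n ^ 'n" where
  "shear j k = (\<chi> i l. (if i = l then 1 else 0) - (if l = j then k $ i else 0))"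

lemma shear_mult: "shear j k *v x = x - (x $ j) *\<^sub>R k" for x :: "real ^ 'n::finite"
proof -
  have "(\<Sum>l\<in>UNIV. ((if i = l then 1 else 0) - (if l = j then k $ i else 0)) * x $ l)
      = x $ i - k $ i * x $ j" for i
    by (simp add: left_diff_distrib sum_subtractf if_distrib[of "\<lambda>t. t * _"] cong: if_cong)
  then show ?thesis
    by (simp add: vec_eq_iff shear_def matrix_vector_mult_def mult.commute)
qed

lemma integer_inverses_shear:
  fixes k :: "real ^ 'n::finite"
  assumes "k \<in> integer_vectors" "k $ j = 0"
  shows "integer_inverses (shear j (- k)) (shear j k)"
proof -
  have "shear j (- k) ** shear j k = mat 1"
    using assms(2) by (simp add: matrix_eq shear_mult flip: matrix_vector_mul_assoc)
  moreover have "integer_matrix (shear j k)" "integer_matrix (shear j (- k))"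
    using assms(1) by (auto simp: integer_matrix_def shear_def integer_vectors_def)
  ultimately show ?thesis
    by (simp add: integer_inverses_def)
qed

text \<open>
  One step of the algorithm: division with remainder of least absolute value, by the pivot
  \<open>w $ j\<close>, in all the other coordinates at once.
\<close>

lemma reduce_modulo_coordinate:
  fixes w :: "real ^ 'n::finite"
  assumes "w $ j \<noteq> 0"
  obtains A B where "integer_inverses A B" "(B *v w) $ j = w $ j"
    "\<And>i. i \<noteq> j \<Longrightarrow> \<bar>(B *v w) $ i\<bar> \<le> \<bar>w $ j\<bar> / 2"
proof
  define k :: "real ^ 'n" where
    "k = (\<chi> i. if i = j then 0 else of_int (round (w $ i / w $ j)))"
  have k: "k \<in> integer_vectors" "k $ j = 0"
    by (auto simp: k_def integer_vectors_def)
  show "integer_inverses (shear j (- k)) (shear j k)"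
    by (rule integer_inverses_shear[OF k])
  show "(shear j k *v w) $ j = w $ j"
    using k by (simp add: shear_mult)
  fix i
  assume "i \<noteq> j"
  then have "(shear j k *v w) $ i = w $ j * (w $ i / w $ j - of_int (round (w $ i / w $ j)))"
    using assms by (simp add: shear_mult k_def right_diff_distrib)
  moreover have "\<bar>w $ i / w $ j - of_int (round (w $ i / w $ j))\<bar> \<le> 1 / 2"
    using of_int_round_abs_le[of "w $ i / w $ j"] by (simp add: abs_minus_commute)
  ultimately show "\<bar>(shear j k *v w) $ i\<bar> \<le> \<bar>w $ j\<bar> / 2"
    using mult_left_mono[of _ "1 / 2" "\<bar>w $ j\<bar>"] by (simp add: abs_mult)
qed

text \<open>
  The pivots halve: a remainder vector with a single nonzero coordinate is a multiple of a
  standard basis vector, so irrationality always leaves a nonzero remainder to pivot on.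
\<close>

lemma irrational_orbit_small_pivot:
  fixes v :: "real ^ 'n::finite"
  assumes irr: "irrational_vector v"
  shows "\<exists>A B j. integer_inverses A B \<and> (B *v v) $ j \<noteq> 0 \<and> \<bar>(B *v v) $ j\<bar> \<le> norm v / 2 ^ m"
proof (induction m)
  case 0
  have "v \<noteq> 0"
    using irr by (force simp: irrational_vector_def integer_vectors_def)
  then obtain j where "v $ j \<noteq> 0"
    by (auto simp: vec_eq_iff)
  then show ?case
    using integer_inverses_mat_1 component_le_norm_cart[of v j]
    by (intro exI[of _ "mat 1"] exI[of _ j]) simp
next
  case (Suc m)
  then obtain A B j where AB: "integer_inverses A B"
    and nz: "(B *v v) $ j \<noteq> 0" and le: "\<bar>(B *v v) $ j\<bar> \<le> norm v / 2 ^ m"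
    by blast
  obtain C D where CD: "integer_inverses C D"
    and small: "\<And>i. i \<noteq> j \<Longrightarrow> \<bar>(D *v (B *v v)) $ i\<bar> \<le> \<bar>(B *v v) $ j\<bar> / 2"
    using reduce_modulo_coordinate[OF nz] by metis
  define w where "w = D *v (B *v v)"
  have "irrational_vector w"
    unfolding w_def
    by (intro irrational_vector_integer_inverses[OF CD] irrational_vector_integer_inverses[OF AB] irr)
  moreover have "axis j 1 \<in> integer_vectors"
    by (auto simp: integer_vectors_def axis_def)
  ultimately have "w \<noteq> w $ j *\<^sub>R axis j 1"
    unfolding irrational_vector_def by blast
  then obtain i where "w $ i \<noteq> (w $ j *\<^sub>R axis j 1) $ i"
    unfolding vec_eq_iff by blast
  then have i: "i \<noteq> j" "w $ i \<noteq> 0"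
    by (auto simp: axis_def split: if_splits)
  have "\<bar>w $ i\<bar> \<le> norm v / 2 ^ Suc m"
    using small[OF i(1)] le by (simp add: w_def)
  moreover have "w = (D ** B) *v v"
    by (simp add: w_def matrix_vector_mul_assoc)
  ultimately show ?case
    using i(2) integer_inverses_mul[OF AB CD] by metis
qed

lemma irrational_orbit_small:
  fixes v :: "real ^ 'n::finite"
  assumes irr: "irrational_vector v" and "0 < e"
  obtains A B where "integer_inverses A B" "norm (B *v v) < e"
proof -
  let ?N = "real CARD('n)"
  obtain m where m: "norm v * ?N / e < 2 ^ m"
    using real_arch_pow[of 2 "norm v * ?N / e"] by auto
  obtain A B j where AB: "integer_inverses A B"
    and nz: "(B *v v) $ j \<noteq> 0" and le: "\<bar>(B *v v) $ j\<bar> \<le> norm v / 2 ^ m"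
    using irrational_orbit_small_pivot[OF irr] by blast
  obtain C D where CD: "integer_inverses C D" "(D *v (B *v v)) $ j = (B *v v) $ j"
    and small: "\<And>i. i \<noteq> j \<Longrightarrow> \<bar>(D *v (B *v v)) $ i\<bar> \<le> \<bar>(B *v v) $ j\<bar> / 2"
    using reduce_modulo_coordinate[OF nz] by metis
  define w where "w = D *v (B *v v)"
  have "\<bar>w $ i\<bar> \<le> norm v / 2 ^ m" for i
    using small[of i] CD(2) le by (cases "i = j") (auto simp: w_def)
  then have "(\<Sum>i\<in>UNIV. \<bar>w $ i\<bar>) \<le> ?N * (norm v / 2 ^ m)"
    by (rule sum_bounded_above)
  also have "\<dots> < e"
    using m \<open>0 < e\<close> by (simp add: field_simps)
  finally have "norm w < e"
    using norm_le_l1_cart[of w] by linarith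
  moreover have "w = (D ** B) *v v"
    by (simp add: w_def matrix_vector_mul_assoc)
  ultimately show ?thesis
    using integer_inverses_mul[OF AB CD(1)] that by metis
qed


section \<open>The cotangent lift of a torus automorphism\<close>

definition torus_map :: "real ^ 'n ^ 'n \<Rightarrow> 'n::finite torus \<Rightarrow> 'n torus" where
  "torus_map A q = torus_proj (A *v rep_torus q)"

lemma torus_proj_rep: "torus_proj (rep_torus q) = q"
  by (rule Quotient3_abs_rep[OF Quotient3_torus])

lemma torus_map_proj:
  assumes "integer_matrix A"
  shows "torus_map A (torus_proj x) = torus_proj (A *v x)"
proof -
  have "lattice_rel (rep_torus (torus_proj x)) x"
    using torus_proj_rep torus.abs_eq_iff by blast
  then have "lattice_rel (A *v rep_torus (torus_proj x)) (A *v x)"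
    using integer_matrix_vector_mul[OF assms]
    by (simp add: lattice_rel_def flip: matrix_vector_mult_diff_distrib)
  then show ?thesis
    by (simp add: torus_map_def torus.abs_eq_iff)
qed

lemma torus_map_inverse:
  assumes "integer_inverses A B"
  shows "torus_map A (torus_map B q) = q"
proof -
  have "torus_map A (torus_map B q) = torus_proj (A *v (B *v rep_torus q))"
    using assms unfolding torus_map_def[of B] by (simp add: torus_map_proj integer_inverses_def)
  then show ?thesis
    by (simp add: integer_inverses_cancel[OF assms] torus_proj_rep)
qed

lemma continuous_on_torus_map:
  assumes "integer_matrix A"
  shows "continuous_on UNIV (torus_map A)"
  unfolding continuous_on_open_vimage[OF open_UNIV]
proof (intro allI impI)
  fix U :: "'a torus set"
  assume "open U"
  then have "open ((\<lambda>x. A *v x) -` (torus_proj -` U))"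
    using open_vimage[OF _ matrix_vector_mult_linear_continuous_on] by (simp add: open_torus_def)
  moreover have "torus_proj -` (torus_map A -` U) = (\<lambda>x. A *v x) -` (torus_proj -` U)"
    by (auto simp: torus_map_proj[OF assms])
  ultimately show "open (torus_map A -` U \<inter> UNIV)"
    by (simp add: open_torus_def)
qed

text \<open>
  For \<open>B\<close> inverse to \<open>A\<close>, the covector \<open>p\<close> is carried along by \<open>p v* B = B\<^sup>T p\<close>, the inverse
  transpose of \<open>A\<close>, so that its pairing with velocities, and hence the canonical one-form,
  is preserved.
\<close>

definition cotangent_lift ::
  "real ^ 'n ^ 'n \<Rightarrow> real ^ 'n ^ 'n \<Rightarrow> 'n::finite cotangent_torus \<Rightarrow> 'n cotangent_torus" where
  "cotangent_lift A B z = (torus_map A (fst z), snd z v* B)"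

definition linear_lift ::
  "real ^ 'n ^ 'n \<Rightarrow> real ^ 'n ^ 'n \<Rightarrow> (real ^ 'n) \<times> (real ^ 'n) \<Rightarrow> (real ^ 'n) \<times> (real ^ 'n)" where
  "linear_lift A B z = (A *v fst z, snd z v* B)"

lemma bounded_linear_linear_lift: "bounded_linear (linear_lift A B)"
  for A :: "real ^ 'n::finite ^ 'n"
  unfolding linear_lift_def transpose_matrix_vector[symmetric]
  by (intro bounded_linear_Pair bounded_linear_compose[OF matrix_vector_mul_bounded_linear]
      bounded_linear_fst bounded_linear_snd)

lemma cot_proj_linear_lift:
  assumes "integer_matrix A"
  shows "cot_proj (linear_lift A B w) = cotangent_lift A B (cot_proj w)"
  by (simp add: cot_proj_def linear_lift_def cotangent_lift_def torus_map_proj[OF assms])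

lemma vector_matrix_mult_cancel:
  assumes "integer_inverses A B"
  shows "(x v* A) v* B = x"
  using assms by (simp add: integer_inverses_def vector_matrix_mul_assoc)

lemma homeomorphism_cotangent_lift:
  fixes A B :: "real ^ 'n::finite ^ 'n"
  assumes AB: "integer_inverses A B"
  shows "homeomorphism UNIV (range (cotangent_lift A B)) (cotangent_lift A B) (cotangent_lift B A)"
proof -
  have BA: "integer_inverses B A"
    by (rule integer_inverses_commute[OF AB])
  have cont: "continuous_on UNIV (cotangent_lift C D)" if "integer_inverses C D"
    for C D :: "real ^ 'n ^ 'n"
    unfolding cotangent_lift_def transpose_matrix_vector[symmetric] using that
    by (intro continuous_on_Pair continuous_on_compose2[OF continuous_on_torus_map[of C]]
        continuous_on_compose2[OF matrix_vector_mult_linear_continuous_on]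
        continuous_on_fst continuous_on_snd continuous_on_id)
      (auto simp: integer_inverses_def)
  have inv: "cotangent_lift C D (cotangent_lift D C z) = z" if "integer_inverses C D"
    for C D :: "real ^ 'n ^ 'n" and z
    by (simp add: cotangent_lift_def torus_map_inverse[OF that] vector_matrix_mult_cancel[OF that])
  show ?thesis
    by (rule homeomorphismI)
      (auto simp: inv[OF AB] inv[OF BA] intro: cont[OF AB] continuous_on_subset[OF cont[OF BA]])
qed


section \<open>Smoothness and local lifts\<close>

lemma C_k_on_const: "C_k_on k S (\<lambda>x. c)"
  by (induction k arbitrary: c) auto

lemma smooth_on_bounded_linear:
  assumes "bounded_linear f"
  shows "smooth_on S f"
  unfolding smooth_on_def
proof
  fix k
  have "frechet_derivative f (at x) = f" for x
    using bounded_linear_imp_has_derivative[OF assms] by (metis frechet_derivative_at)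
  then show "C_k_on k S f"
    using assms
    by (cases k) (auto simp: C_k_on_const linear_continuous_on bounded_linear_imp_differentiable)
qed

text \<open>
  Any other local lift differs from the linear one by a lattice-valued continuous function.
  Such a function is locally constant because the lattice is discrete, so every local lift has
  the same differential.
\<close>

lemma local_lift_has_derivative:
  fixes A B :: "real ^ 'n::finite ^ 'n"
  assumes A: "integer_matrix A" and lift: "local_lift U (cotangent_lift A B) W F" and w: "w \<in> W"
  shows "(F has_derivative linear_lift A B) (at w)"
proof -
  let ?L = "linear_lift A B"
  define d where "d = (\<lambda>x. F x - ?L x)"
  have "open W" and contF: "continuous_on W F"
    and proj: "\<And>x. x \<in> W \<Longrightarrow> cot_proj (F x) = cotangent_lift A B (cot_proj x)"
    using lift by (auto simp: local_lift_def)
  have contd: "continuous_on W d"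
    unfolding d_def
    by (intro continuous_intros contF linear_continuous_on bounded_linear_linear_lift)
  have lattice: "fst (d x) \<in> integer_vectors" "snd (d x) = 0" if "x \<in> W" for x
  proof -
    have "cot_proj (F x) = cot_proj (?L x)"
      using proj[OF that] by (simp add: cot_proj_linear_lift[OF A])
    then show "fst (d x) \<in> integer_vectors" "snd (d x) = 0"
      by (auto simp: cot_proj_def d_def torus.abs_eq_iff lattice_rel_def)
  qed
  obtain V where V: "open V" "w \<in> V" "\<And>x. x \<in> V \<Longrightarrow> x \<in> W \<and> dist (d x) (d w) < 1"
  proof
    have "open (W \<inter> d -` ball (d w) 1)"
      using continuous_open_preimage[OF contd \<open>open W\<close> open_ball] .
    then show "open (W \<inter> d -` ball (d w) 1)" .
  qed (use w in \<open>auto simp: dist_commute\<close>)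
  have const: "d x = d w" if "x \<in> V" for x
  proof -
    have x: "x \<in> W" "dist (d x) (d w) < 1"
      using V(3)[OF that] by auto
    have "fst (d x) $ i = fst (d w) $ i" for i
    proof -
      have "\<bar>fst (d x) $ i - fst (d w) $ i\<bar> \<le> norm (fst (d x - d w))"
        using component_le_norm_cart[of "fst (d x - d w)" i] by simp
      also have "\<dots> \<le> norm (d x - d w)"
        by (metis norm_fst_le prod.collapse)
      also have "\<dots> < 1"
        using x by (simp add: dist_norm)
      finally have "\<bar>fst (d x) $ i - fst (d w) $ i\<bar> < 1" .
      moreover have "fst (d x) $ i \<in> \<int>" "fst (d w) $ i \<in> \<int>"
        using lattice(1)[OF x(1)] lattice(1)[OF w] by (auto simp: integer_vectors_def)
      ultimately show ?thesis
        using Ints_eq_abs_less1 by blast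
    qed
    then show ?thesis
      using lattice(2)[OF x(1)] lattice(2)[OF w] by (simp add: prod_eq_iff vec_eq_iff)
  qed
  have "((\<lambda>x. ?L x + d w) has_derivative ?L) (at w)"
    by (intro has_derivative_add_const bounded_linear_imp_has_derivative bounded_linear_linear_lift)
  then show ?thesis
  proof (rule has_derivative_transform_within_open[OF _ V(1,2)])
    fix x assume "x \<in> V"
    then show "?L x + d w = F x"
      using const[of x] by (simp add: d_def algebra_simps)
  qed
qed

lemma smooth_embedding_cotangent_lift:
  fixes A B :: "real ^ 'n::finite ^ 'n"
  assumes AB: "integer_inverses A B"
  shows "smooth_embedding UNIV (cotangent_lift A B)"
proof -
  have A: "integer_matrix A" and BA: "integer_inverses B A"
    using AB integer_inverses_commute by (auto simp: integer_inverses_def)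
  have "local_lift UNIV (cotangent_lift A B) UNIV (linear_lift A B)"
    by (simp add: local_lift_def cot_proj_linear_lift[OF A] linear_continuous_on
        bounded_linear_linear_lift)
  then have "smooth_map UNIV (cotangent_lift A B)"
    using smooth_on_bounded_linear[OF bounded_linear_linear_lift]
    unfolding smooth_map_def by blast
  moreover have "inj (linear_lift A B)"
    by (rule inj_on_inverseI[where g = "linear_lift B A"])
      (simp add: linear_lift_def integer_inverses_cancel[OF BA] vector_matrix_mult_cancel[OF BA])
  ultimately have "immersion UNIV (cotangent_lift A B)"
    using frechet_derivative_at[OF local_lift_has_derivative[OF A]]
    unfolding immersion_def by metis
  then show ?thesis
    using homeomorphism_cotangent_lift[OF AB] unfolding smooth_embedding_def by blast
qed

lemma preserves_omega_cotangent_lift: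
  fixes A B :: "real ^ 'n::finite ^ 'n"
  assumes AB: "integer_inverses A B"
  shows "preserves_omega UNIV (cotangent_lift A B)"
proof -
  have A: "integer_matrix A"
    using AB by (simp add: integer_inverses_def)
  have "(p v* B) \<bullet> (A *v q) = p \<bullet> q" for p q
    by (simp add: dot_lmul_matrix integer_inverses_cancel[OF integer_inverses_commute[OF AB]])
  then have "omega_can z (linear_lift A B \<xi>) (linear_lift A B \<eta>) = omega_can w \<xi> \<eta>" for z w \<xi> \<eta>
    by (simp add: omega_can_eq linear_lift_def)
  then show ?thesis
    using frechet_derivative_at[OF local_lift_has_derivative[OF A]]
    unfolding preserves_omega_def by metis
qed


section \<open>Embedding sets with bounded fibers\<close>

lemma fiber_bounded_embeds:
  fixes v :: "real ^ 'n::finite"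
  assumes v: "norm v = 1" and irr: "irrational_vector v" and D: "fiber_bounded D"
  shows "\<exists>f. symplectic_embedding D (Y_domain 1 v) f"
proof -
  obtain R where R: "0 < R" "\<And>z. z \<in> D \<Longrightarrow> norm (snd z) \<le> R"
    using D unfolding fiber_bounded_def bounded_pos by auto
  obtain A B where AB: "integer_inverses A B" and small: "norm (B *v v) < 1 / R"
    using irrational_orbit_small[OF irr, of "1 / R"] R(1) by auto
  have "cotangent_lift A B z \<in> Y_domain 1 v" if "z \<in> D" for z
  proof -
    have "\<bar>(snd z v* B) \<bullet> v\<bar> = \<bar>snd z \<bullet> (B *v v)\<bar>"
      by (simp add: dot_lmul_matrix)
    also have "\<dots> \<le> norm (snd z) * norm (B *v v)"
      by (rule Cauchy_Schwarz_ineq2)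
    also have "\<dots> \<le> R * norm (B *v v)"
      by (rule mult_right_mono[OF R(2)[OF that]]) simp
    also have "\<dots> < 1"
      using small R(1) by (simp add: field_simps)
    finally show ?thesis
      by (simp add: Y_domain_eq[OF v] cotangent_lift_def)
  qed
  then have "symplectic_embedding D (Y_domain 1 v) (cotangent_lift A B)"
    using smooth_embedding_cotangent_lift[OF AB] preserves_omega_cotangent_lift[OF AB]
    unfolding symplectic_embedding_def by (auto intro!: exI[of _ UNIV] exI[of _ "cotangent_lift A B"])
  then show ?thesis
    by blast
qed

lemma fiber_bounded_P_domain: "fiber_bounded (P_domain r :: 'n::finite cotangent_torus set)"
  unfolding fiber_bounded_def
proof (rule boundedI)
  fix x :: "real ^ 'n"
  assume "x \<in> snd ` (P_domain r :: 'n cotangent_torus set)"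
  then have "\<And>i. 0 \<le> x $ i" "(\<Sum>i\<in>UNIV. x $ i) \<le> r"
    by (auto simp: P_domain_def)
  then show "norm x \<le> r"
    using norm_le_l1_cart[of x] by simp
qed

theorem theorem2:
  fixes v :: "real ^ 'n::finite"
  assumes "3 \<le> CARD('n)"
    and "norm v = 1"
    and "irrational_vector v"
  shows "(\<forall>r>0. \<exists>f. symplectic_embedding (P_domain r) (Y_domain 1 v) f) \<and>
    (\<forall>D :: 'n cotangent_torus set. is_domain D \<and> fiber_bounded D \<longrightarrow>
       (\<exists>f. symplectic_embedding D (Y_domain 1 v) f))"
  using fiber_bounded_embeds[OF assms(2,3)] fiber_bounded_P_domain by blast

end
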